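(* Let $M$ be a real $d\times n$ matrix of tropical rank $2$. Then its Kapranov rank equals $2$ as well.
   Context: Tropical rank: a square matrix $(m_{ij})\in\mathbb{R}^{r\times r}$ is tropically singular if $\min_{\sigma\in\mathcal{S}_r}(m_{1\sigma_1}+\cdots+m_{r\sigma_r})$ is attained by at least two permutations $\sigma$; otherwise it is tropically non-singular. The tropical rank of $M$ is the largest $r$ such that $M$ has a tropically non-singular $r\times r$ submatrix. Kapranov rank: let $\tilde K$ be the field of formal power series $f=\sum_a c_a t^a$ with complex coefficients and real exponents, with well-ordered support; for $f\ne 0$ let $\deg(f)$ be the smallest exponent $a$ with $c_a\neq 0$. A tropical linear space in $\mathbb{R}^d$ is a set of the form $\{(\deg f_1,\dots,\deg f_d) : (f_1,\dots,f_d)\in V,\ \text{all } f_i\ne 0\}$, where $V$ is a linear subspace of $\tilde K^d$ (equivalently, the common zero set of linear forms $a_1x_1+\cdots+a_dx_d$ with coefficients in $\tilde K$); its dimension is $\dim_{\tilde K}V$. The Kapranov rank of $M\in\mathbb{R}^{d\times n}$ is the smallest dimension of a tropical linear space in $\mathbb{R}^d$ containing all columns of $M$. *)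

theory Defs
  imports "HOL-Analysis.Analysis"
begin

section \<open>Well-ordered sets of reals\<close>

lemma wfp_on_less_iff_least:
  fixes A :: "'a::linorder set"
  shows "wfp_on A (<) \<longleftrightarrow> (\<forall>B. B \<subseteq> A \<and> B \<noteq> {} \<longrightarrow> (\<exists>m\<in>B. \<forall>b\<in>B. m \<le> b))"
proof -
  have "(\<forall>y. y < z \<longrightarrow> y \<notin> B) \<longleftrightarrow> (\<forall>b\<in>B. z \<le> b)" for z :: 'a and B
    by (auto simp: not_less[symmetric])
  then show ?thesis unfolding wfp_on_iff_ex_minimal by (simp add: imp_conjL)
qed

lemma wfp_on_less_least:
  fixes A :: "'a::linorder set"
  assumes "wfp_on A (<)" "B \<subseteq> A" "B \<noteq> {}"
  obtains m where "m \<in> B" "\<And>b. b \<in> B \<Longrightarrow> m \<le> b"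
proof -
  have "\<exists>m\<in>B. \<forall>b\<in>B. m \<le> b"
    using assms(1)[unfolded wfp_on_less_iff_least, rule_format, of B] assms(2,3) by simp
  then show thesis using that by (elim bexE) simp
qed

lemma wfp_on_less_mono_subseq:
  fixes a :: "nat \<Rightarrow> 'a::linorder"
  assumes A: "wfp_on A (<)" and a: "\<And>n. a n \<in> A"
  obtains r where "strict_mono r" "incseq (a \<circ> r)"
proof -
  obtain f where f: "strict_mono f" "monoseq (\<lambda>n. a (f n))"
    using seq_monosub[of a] by (elim exE conjE)
  show thesis
  proof (cases "incseq (a \<circ> f)")
    case True
    show thesis by (rule that[OF f(1) True])
  next
    case False
    then have dec: "decseq (\<lambda>n. a (f n))"
      using f(2) unfolding monoseq_iff o_def by blast
    obtain m where m: "m \<in> range (\<lambda>n. a (f n))"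
      "\<And>b. b \<in> range (\<lambda>n. a (f n)) \<Longrightarrow> m \<le> b"
      by (rule wfp_on_less_least[OF A, of "range (\<lambda>n. a (f n))"]) (use a in auto)
    from m(1) obtain N where N: "m = a (f N)" by auto
    have const: "a (f (N + n)) = m" for n
    proof (rule antisym)
      show "a (f (N + n)) \<le> m" unfolding N by (rule decseqD[OF dec]) simp
      show "m \<le> a (f (N + n))" by (rule m(2)) simp
    qed
    show thesis
    proof (rule that)
      show "strict_mono (\<lambda>n. f (N + n))"
        by (rule strict_monoI) (rule strict_monoD[OF f(1)], simp)
      show "incseq (a \<circ> (\<lambda>n. f (N + n)))"
        unfolding incseq_def o_def by (simp only: const order_refl simp_thms)
    qed
  qed
qed

lemma wfp_on_less_no_descent:
  fixes a :: "nat \<Rightarrow> 'a::linorder"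
  assumes A: "wfp_on A (<)" and a: "\<And>n. a n \<in> A"
  shows "\<exists>n. a n \<le> a (Suc n)"
proof -
  have "range a \<subseteq> A" using a by auto
  then obtain m where m: "m \<in> range a" "\<And>b. b \<in> range a \<Longrightarrow> m \<le> b"
    using wfp_on_less_least[OF A] by blast
  from m(1) obtain n where "m = a n" by blast
  with m(2)[of "a (Suc n)"] show ?thesis by auto
qed

lemma wfp_on_less_sumset:
  fixes A B :: "'a::linordered_ab_group_add set"
  assumes A: "wfp_on A (<)" and B: "wfp_on B (<)"
  shows "wfp_on {a + b |a b. a \<in> A \<and> b \<in> B} (<)"
proof (rule ccontr)
  assume "\<not> ?thesis"
  then obtain S where S: "S \<subseteq> {a + b |a b. a \<in> A \<and> b \<in> B}" "S \<noteq> {}"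
    "\<And>m. m \<in> S \<Longrightarrow> \<exists>b\<in>S. b < m"
    unfolding wfp_on_less_iff_least by (meson not_le)
  obtain s where s: "\<And>n. s n \<in> S" "\<And>n. s (Suc n) < s n"
    using dependent_nat_choice[of "\<lambda>_ x. x \<in> S" "\<lambda>_ x y. y < x"] S by blast
  have "\<forall>n. \<exists>a b. a \<in> A \<and> b \<in> B \<and> s n = a + b" using s(1) S(1) by blast
  then obtain a b where ab: "\<And>n. a n \<in> A" "\<And>n. b n \<in> B" "\<And>n. s n = a n + b n"
    by metis
  obtain r where r: "strict_mono r" "incseq (a \<circ> r)"
    by (rule wfp_on_less_mono_subseq[OF A ab(1)])
  obtain n where n: "b (r n) \<le> b (r (Suc n))"
    using wfp_on_less_no_descent[OF B, of "b \<circ> r"] ab(2) by auto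
  have "a (r n) \<le> a (r (Suc n))" using r(2) by (simp add: incseq_Suc_iff)
  with n have "s (r n) \<le> s (r (Suc n))" by (simp add: ab(3) add_mono)
  moreover have "s (r (Suc n)) < s (r n)"
  proof -
    have "strict_mono (\<lambda>i. - s i)" using s(2) by (simp add: strict_mono_Suc_iff)
    moreover have "r n < r (Suc n)" using r(1) by (simp add: strict_mono_def)
    ultimately show ?thesis by (meson neg_less_iff_less strict_monoD)
  qed
  ultimately show False by simp
qed

lemma wfp_on_less_Un:
  fixes A B :: "'a::linorder set"
  assumes A: "wfp_on A (<)" and B: "wfp_on B (<)"
  shows "wfp_on (A \<union> B) (<)"
  unfolding wfp_on_less_iff_least
proof (intro allI impI)
  fix S assume S: "S \<subseteq> A \<union> B \<and> S \<noteq> {}"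
  show "\<exists>m\<in>S. \<forall>b\<in>S. m \<le> b"
  proof (cases "S \<inter> A = {} \<or> S \<inter> B = {}")
    case True
    then have "S \<subseteq> A \<or> S \<subseteq> B" using S by blast
    then obtain m where "m \<in> S" "\<And>b. b \<in> S \<Longrightarrow> m \<le> b"
      using wfp_on_less_least[OF A, of S] wfp_on_less_least[OF B, of S] S by metis
    then show ?thesis by blast
  next
    case False
    obtain m where m: "m \<in> S \<inter> A" "\<And>b. b \<in> S \<inter> A \<Longrightarrow> m \<le> b"
      using wfp_on_less_least[OF A, of "S \<inter> A"] False by blast
    obtain k where k: "k \<in> S \<inter> B" "\<And>b. b \<in> S \<inter> B \<Longrightarrow> k \<le> b"
      using wfp_on_less_least[OF B, of "S \<inter> B"] False by blast
    have "min m k \<in> S" using m(1) k(1) by (simp add: min_def)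
    moreover have "min m k \<le> b" if "b \<in> S" for b
      using that S m(2)[of b] k(2)[of b] by (auto simp: min_le_iff_disj)
    ultimately show ?thesis by blast
  qed
qed

lemma wfp_on_less_finite_sums:
  fixes A B :: "'a::linordered_ab_group_add set"
  assumes A: "wfp_on A (<)" and B: "wfp_on B (<)"
  shows "finite {a \<in> A. x - a \<in> B}"
proof (rule ccontr)
  let ?F = "{a \<in> A. x - a \<in> B}"
  assume "infinite ?F"
  then obtain a :: "nat \<Rightarrow> 'a" where a: "inj a" "range a \<subseteq> ?F"
    using infinite_countable_subset by blast
  have aA: "a n \<in> A" and aB: "x - a n \<in> B" for n using a(2) by auto
  obtain r where r: "strict_mono r" "incseq (a \<circ> r)"
    by (rule wfp_on_less_mono_subseq[OF A aA])
  obtain n where "x - a (r n) \<le> x - a (r (Suc n))"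
    using wfp_on_less_no_descent[OF B, of "\<lambda>n. x - a (r n)"] aB by auto
  moreover have "a (r n) \<le> a (r (Suc n))" using r(2) by (simp add: incseq_Suc_iff)
  ultimately have "a (r n) = a (r (Suc n))" by simp
  then have "r n = r (Suc n)" using a(1) by (simp add: inj_eq)
  then show False using r(1) by (metis lessI less_irrefl strict_mono_def)
qed

section \<open>The field of generalized power series\<close>

text \<open>A series is represented by its coefficient function, \<open>f a\<close> being the coefficient of
  \<open>t\<close> to the power \<open>a\<close>. As the order of the reals is linear, well-foundedness of \<open>(<)\<close> on the
  support says that the support is well-ordered.\<close>

typedef gseries = "{f :: real \<Rightarrow> complex. wfp_on {a. f a \<noteq> 0} (<)}"
  morphisms gcoeff Abs_gseries
  by (rule exI[of _ "\<lambda>_. 0"]) (simp add: wfp_on_less_iff_least)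

setup_lifting type_definition_gseries

definition supp :: "gseries \<Rightarrow> real set" where
  "supp f = {a. gcoeff f a \<noteq> 0}"

lemma wfp_on_supp: "wfp_on (supp f) (<)"
  using gcoeff[of f] by (simp add: supp_def)

lemma not_in_supp: "a \<notin> supp f \<Longrightarrow> gcoeff f a = 0"
  by (simp add: supp_def)

lemma gseries_eqI: "(\<And>a. gcoeff f a = gcoeff g a) \<Longrightarrow> f = g"
  by (rule gcoeff_inject[THEN iffD1]) (rule ext)

lift_definition gmonom :: "complex \<Rightarrow> real \<Rightarrow> gseries" is
  "\<lambda>c a x. if x = a then c else 0"
  by (auto simp: wfp_on_less_iff_least)

instantiation gseries :: "{zero, one, plus, uminus, minus, times}"
begin

lift_definition zero_gseries :: gseries is "\<lambda>_. 0"
  by (simp add: wfp_on_less_iff_least)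

definition one_gseries :: gseries where
  "1 = gmonom 1 0"

lift_definition plus_gseries :: "gseries \<Rightarrow> gseries \<Rightarrow> gseries" is
  "\<lambda>f g x. f x + g x"
  subgoal for f g
    by (rule wfp_on_subset[OF wfp_on_less_Un[of "{x. f x \<noteq> 0}" "{x. g x \<noteq> 0}"]]) auto
  done

lift_definition uminus_gseries :: "gseries \<Rightarrow> gseries" is "\<lambda>f x. - f x"
  by simp

definition minus_gseries :: "gseries \<Rightarrow> gseries \<Rightarrow> gseries" where
  "f - g = f + - (g :: gseries)"

text \<open>The index set of the convolution is finite by \<open>wfp_on_less_finite_sums\<close>.\<close>

lift_definition times_gseries :: "gseries \<Rightarrow> gseries \<Rightarrow> gseries" is
  "\<lambda>f g x. \<Sum>a\<in>{a. f a \<noteq> 0 \<and> g (x - a) \<noteq> 0}. f a * g (x - a)"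
  subgoal for f g
  proof (rule wfp_on_subset[OF wfp_on_less_sumset[of "{x. f x \<noteq> 0}" "{x. g x \<noteq> 0}"]])
    show "{x. (\<Sum>a\<in>{a. f a \<noteq> 0 \<and> g (x - a) \<noteq> 0}. f a * g (x - a)) \<noteq> 0}
      \<subseteq> {a + b |a b. a \<in> {x. f x \<noteq> 0} \<and> b \<in> {x. g x \<noteq> 0}}"
    proof
      fix x assume "x \<in> {x. (\<Sum>a\<in>{a. f a \<noteq> 0 \<and> g (x - a) \<noteq> 0}. f a * g (x - a)) \<noteq> 0}"
      then have "{a. f a \<noteq> 0 \<and> g (x - a) \<noteq> 0} \<noteq> {}" by (auto simp del: Collect_empty_eq)
      then obtain a where "f a \<noteq> 0" "g (x - a) \<noteq> 0" by auto
      then show "x \<in> {a + b |a b. a \<in> {x. f x \<noteq> 0} \<and> b \<in> {x. g x \<noteq> 0}}"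
        by (intro CollectI exI[of _ a] exI[of _ "x - a"]) auto
    qed
  qed auto
  done

instance ..

end

lemma coeff_monom: "gcoeff (gmonom c a) x = (if x = a then c else 0)"
  by transfer simp

lemma coeff_zero [simp]: "gcoeff 0 x = 0"
  by transfer simp

lemma coeff_one: "gcoeff 1 x = (if x = 0 then 1 else 0)"
  by (simp add: one_gseries_def coeff_monom)

lemma coeff_add [simp]: "gcoeff (f + g) x = gcoeff f x + gcoeff g x"
  by transfer simp

lemma coeff_uminus [simp]: "gcoeff (- f) x = - gcoeff f x"
  by transfer simp

lemma coeff_diff [simp]: "gcoeff (f - g) x = gcoeff f x - gcoeff g x"
  by (simp add: minus_gseries_def)

lemma finite_conv_index:
  assumes "wfp_on A (<)" "wfp_on B (<)"
  shows "finite {a :: real. a \<in> A \<and> x - a \<in> B}"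
  using wfp_on_less_finite_sums[OF assms] by simp

lemma coeff_mult_supset:
  assumes A: "supp f \<subseteq> A" "wfp_on A (<)" and B: "supp g \<subseteq> B" "wfp_on B (<)"
  shows "gcoeff (f * g) x = (\<Sum>a\<in>{a. a \<in> A \<and> x - a \<in> B}. gcoeff f a * gcoeff g (x - a))"
proof -
  have "gcoeff (f * g) x
      = (\<Sum>a\<in>{a. gcoeff f a \<noteq> 0 \<and> gcoeff g (x - a) \<noteq> 0}. gcoeff f a * gcoeff g (x - a))"
    by transfer simp
  also have "\<dots> = (\<Sum>a\<in>{a. a \<in> A \<and> x - a \<in> B}. gcoeff f a * gcoeff g (x - a))"
    using A B by (intro sum.mono_neutral_left finite_conv_index) (auto simp: supp_def)
  finally show ?thesis .
qed

lemma coeff_mult: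
  "gcoeff (f * g) x = (\<Sum>a\<in>{a. a \<in> supp f \<and> x - a \<in> supp g}. gcoeff f a * gcoeff g (x - a))"
  by (rule coeff_mult_supset) (simp_all add: wfp_on_supp)

lemma supp_mult: "supp (f * g) \<subseteq> {a + b |a b. a \<in> supp f \<and> b \<in> supp g}"
proof
  fix x assume "x \<in> supp (f * g)"
  then have "{a. a \<in> supp f \<and> x - a \<in> supp g} \<noteq> {}"
    by (auto simp: supp_def[of "f * g"] coeff_mult simp del: Collect_empty_eq)
  then obtain a where "a \<in> supp f" "x - a \<in> supp g" by auto
  then show "x \<in> {a + b |a b. a \<in> supp f \<and> b \<in> supp g}"
    by (intro CollectI exI[of _ a] exI[of _ "x - a"]) auto
qed

lemma gseries_mult_assoc: "(f * g) * h = f * (g * (h :: gseries))"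
proof (rule gseries_eqI)
  fix x
  let ?A = "supp f" and ?B = "supp g" and ?C = "supp h"
  let ?AB = "{a + b |a b. a \<in> ?A \<and> b \<in> ?B}" and ?BC = "{b + c |b c. b \<in> ?B \<and> c \<in> ?C}"
  have wf: "wfp_on ?AB (<)" "wfp_on ?BC (<)"
    by (intro wfp_on_less_sumset wfp_on_supp)+
  have "gcoeff (f * g * h) x
      = (\<Sum>s\<in>{s. s \<in> ?AB \<and> x - s \<in> ?C}. gcoeff (f * g) s * gcoeff h (x - s))"
    by (rule coeff_mult_supset) (simp_all only: supp_mult wf wfp_on_supp order_refl)
  also have "\<dots> = (\<Sum>s\<in>{s. s \<in> ?AB \<and> x - s \<in> ?C}. \<Sum>a\<in>{a. a \<in> ?A \<and> s - a \<in> ?B}.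
      gcoeff f a * gcoeff g (s - a) * gcoeff h (x - s))"
    by (simp only: coeff_mult sum_distrib_right)
  also have "\<dots> = (\<Sum>(s, a)\<in>(SIGMA s:{s. s \<in> ?AB \<and> x - s \<in> ?C}. {a. a \<in> ?A \<and> s - a \<in> ?B}).
      gcoeff f a * gcoeff g (s - a) * gcoeff h (x - s))"
    by (intro sum.Sigma ballI finite_conv_index wf wfp_on_supp)
  also have "\<dots> = (\<Sum>(a, b)\<in>(SIGMA a:{a. a \<in> ?A \<and> x - a \<in> ?BC}. {b. b \<in> ?B \<and> x - a - b \<in> ?C}).
      gcoeff f a * (gcoeff g b * gcoeff h (x - a - b)))"
    apply (rule sum.reindex_bij_witness[where j = "\<lambda>(s, a). (a, s - a)" and i = "\<lambda>(a, b). (a + b, a)"])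
        apply (auto simp: algebra_simps)
    subgoal for b a' b'
      by (intro exI[of _ "a' + b' - b"] exI[of _ "x - (a' + b')"]) simp
    done
  also have "\<dots> = (\<Sum>a\<in>{a. a \<in> ?A \<and> x - a \<in> ?BC}. \<Sum>b\<in>{b. b \<in> ?B \<and> x - a - b \<in> ?C}.
      gcoeff f a * (gcoeff g b * gcoeff h (x - a - b)))"
    by (intro sum.Sigma[symmetric] ballI finite_conv_index wf wfp_on_supp)
  also have "\<dots> = (\<Sum>a\<in>{a. a \<in> ?A \<and> x - a \<in> ?BC}. gcoeff f a * gcoeff (g * h) (x - a))"
    by (simp only: coeff_mult sum_distrib_left)
  also have "\<dots> = gcoeff (f * (g * h)) x"
    by (rule coeff_mult_supset[symmetric]) (simp_all only: supp_mult wf wfp_on_supp order_refl)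
  finally show "gcoeff (f * g * h) x = gcoeff (f * (g * h)) x" .
qed

lemma gseries_mult_commute: "f * g = g * (f :: gseries)"
proof (rule gseries_eqI)
  fix x
  show "gcoeff (f * g) x = gcoeff (g * f) x"
    unfolding coeff_mult
    by (rule sum.reindex_bij_witness[where i = "\<lambda>a. x - a" and j = "\<lambda>a. x - a"]) auto
qed

lemma supp_monom: "supp (gmonom c a) \<subseteq> {a}"
  by (auto simp: supp_def coeff_monom)

lemma coeff_monom_mult: "gcoeff (gmonom c a * f) x = c * gcoeff f (x - a)"
proof -
  have "gcoeff (gmonom c a * f) x
      = (\<Sum>b\<in>{b. b \<in> {a} \<and> x - b \<in> supp f}. gcoeff (gmonom c a) b * gcoeff f (x - b))"
    by (rule coeff_mult_supset)
      (simp_all add: supp_monom wfp_on_supp, auto simp: wfp_on_less_iff_least)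
  also have "{b. b \<in> {a} \<and> x - b \<in> supp f} = (if x - a \<in> supp f then {a} else {})"
    by auto
  finally show ?thesis by (auto simp: coeff_monom not_in_supp)
qed

instance gseries :: comm_ring_1
proof
  fix f g h :: gseries
  show "f * g * h = f * (g * h)" by (rule gseries_mult_assoc)
  show "f * g = g * f" by (rule gseries_mult_commute)
  show "1 * f = f"
    by (rule gseries_eqI) (simp add: one_gseries_def coeff_monom_mult)
  show "(f + g) * h = f * h + g * h"
  proof (rule gseries_eqI)
    fix x
    have wf: "wfp_on (supp f \<union> supp g) (<)"
      by (intro wfp_on_less_Un wfp_on_supp)
    have sub: "supp (f + g) \<subseteq> supp f \<union> supp g" by (auto simp: supp_def)
    show "gcoeff ((f + g) * h) x = gcoeff (f * h + g * h) x"
      unfolding coeff_add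
      by (simp only: coeff_mult_supset[OF sub wf order_refl wfp_on_supp]
          coeff_mult_supset[OF Un_upper1 wf order_refl wfp_on_supp]
          coeff_mult_supset[OF Un_upper2 wf order_refl wfp_on_supp]
          coeff_add distrib_right sum.distrib)
  qed
  show "(0 :: gseries) \<noteq> 1"
  proof
    assume "(0 :: gseries) = 1"
    then have "gcoeff 0 0 = gcoeff 1 0" by simp
    then show False by (simp add: coeff_one)
  qed
  show "f + g + h = f + (g + h)" by (rule gseries_eqI) (simp add: add.assoc)
  show "f + g = g + f" by (rule gseries_eqI) (simp add: add.commute)
  show "0 + f = f" by (rule gseries_eqI) simp
  show "- f + f = 0" by (rule gseries_eqI) simp
  show "f - g = f + - g" by (rule minus_gseries_def)
qed

lemma coeff_mult_eq_0:
  assumes "\<And>a. a < \<alpha> \<Longrightarrow> gcoeff f a = 0" "\<And>a. a \<le> \<beta> \<Longrightarrow> gcoeff g a = 0" "x \<le> \<alpha> + \<beta>"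
  shows "gcoeff (f * g) x = 0"
  unfolding coeff_mult
proof (rule sum.neutral, rule ballI)
  fix a
  show "gcoeff f a * gcoeff g (x - a) = 0"
    using assms(1)[of a] assms(2)[of "x - a"] assms(3) by (cases "a < \<alpha>") auto
qed

lemma coeff_mult_eq_0':
  assumes "\<And>a. a < \<alpha> \<Longrightarrow> gcoeff f a = 0" "\<And>a. a < \<beta> \<Longrightarrow> gcoeff g a = 0" "x < \<alpha> + \<beta>"
  shows "gcoeff (f * g) x = 0"
  unfolding coeff_mult
proof (rule sum.neutral, rule ballI)
  fix a
  show "gcoeff f a * gcoeff g (x - a) = 0"
    using assms(1)[of a] assms(2)[of "x - a"] assms(3) by (cases "a < \<alpha>") auto
qed

lemma coeff_power_eq_0:
  assumes "\<And>a. a < s \<Longrightarrow> gcoeff e a = 0" "x < of_nat n * s"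
  shows "gcoeff (e ^ n) x = 0"
  using assms(2)
proof (induction n arbitrary: x)
  case 0
  then show ?case by (simp add: coeff_one)
next
  case (Suc n)
  have "gcoeff (e * e ^ n) x = 0"
  proof (rule coeff_mult_eq_0')
    show "x < s + of_nat n * s" using Suc.prems by (simp add: distrib_right)
  qed (use assms(1) Suc.IH in auto)
  then show ?case by simp
qed

lemma gseries_geometric_inverse:
  assumes s: "s > 0" and e: "\<And>a. a < s \<Longrightarrow> gcoeff e a = 0"
  shows "\<exists>g. (1 - e) * g = 1"
proof -
  define N where "N x = Suc (nat \<lceil>x / s\<rceil>)" for x
  define p where "p n = (\<Sum>i<n. e ^ i)" for n
  have N: "x < of_nat n * s" if "N x \<le> n" for x n
  proof -
    have "x / s < real (N x)" unfolding N_def by linarith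
    also have "\<dots> \<le> real n" using that by simp
    finally show ?thesis using s by (simp add: field_simps)
  qed
  have N_mono: "N x \<le> N y" if "x \<le> y" for x y
    unfolding N_def using s that by (intro Suc_le_mono[THEN iffD2] nat_mono ceiling_mono divide_right_mono) simp_all
  have stable: "gcoeff (p n) x = gcoeff (p (N x)) x" if "N x \<le> n" for n x
    using that
  proof (induction n rule: dec_induct)
    case (step n)
    have "gcoeff (e ^ n) x = 0" by (rule coeff_power_eq_0[OF e N]) (use step in auto)
    then show ?case using step by (simp add: p_def)
  qed simp
  have "wfp_on {x. gcoeff (p (N x)) x \<noteq> 0} (<)"
    unfolding wfp_on_less_iff_least
  proof (intro allI impI)
    fix S assume S: "S \<subseteq> {x. gcoeff (p (N x)) x \<noteq> 0} \<and> S \<noteq> {}"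
    then obtain y where y: "y \<in> S" by blast
    have "S \<inter> {..y} \<subseteq> supp (p (N y))"
    proof
      fix x assume x: "x \<in> S \<inter> {..y}"
      then have "N x \<le> N y" by (intro N_mono) simp
      from stable[OF this] x S show "x \<in> supp (p (N y))" by (auto simp: supp_def)
    qed
    then obtain m where m: "m \<in> S \<inter> {..y}" "\<And>b. b \<in> S \<inter> {..y} \<Longrightarrow> m \<le> b"
      using wfp_on_less_least[OF wfp_on_supp, of "S \<inter> {..y}"] y by blast
    have "m \<le> b" if "b \<in> S" for b
      using m that by (cases "b \<le> y") auto
    then show "\<exists>m\<in>S. \<forall>b\<in>S. m \<le> b" using m(1) by blast
  qed
  then have "\<exists>g. \<forall>x. gcoeff g x = gcoeff (p (N x)) x"
    by (intro exI[of _ "Abs_gseries (\<lambda>x. gcoeff (p (N x)) x)"]) (simp add: Abs_gseries_inverse)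
  then obtain g where g: "\<And>x. gcoeff g x = gcoeff (p (N x)) x" by blast
  have "(1 - e) * g = 1"
  proof (rule gseries_eqI)
    fix x
    have "gcoeff ((1 - e) * (g - p (N x))) x = 0"
    proof (rule coeff_mult_eq_0[of 0 _ x])
      show "gcoeff (1 - e) a = 0" if "a < 0" for a
        using that s by (simp add: coeff_one e)
      show "gcoeff (g - p (N x)) a = 0" if "a \<le> x" for a
        using stable[OF N_mono[OF that]] by (simp add: g)
    qed simp
    then have "gcoeff ((1 - e) * g) x = gcoeff ((1 - e) * p (N x)) x"
      by (simp only: right_diff_distrib coeff_diff right_minus_eq)
    also have "(1 - e) * p (N x) = 1 - e ^ N x"
      unfolding p_def by (rule one_diff_power_eq[symmetric])
    also have "gcoeff (1 - e ^ N x) x = gcoeff 1 x"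
      using coeff_power_eq_0[OF e N[OF order_refl]] by simp
    finally show "gcoeff ((1 - e) * g) x = gcoeff 1 x" .
  qed
  then show ?thesis ..
qed

lemma gseries_nonzero_least:
  assumes "f \<noteq> 0"
  shows "\<exists>d. gcoeff f d \<noteq> 0 \<and> (\<forall>a<d. gcoeff f a = 0)"
proof -
  have "supp f \<noteq> {}" using assms by (auto simp: supp_def intro: gseries_eqI)
  then obtain d where d: "d \<in> supp f" "\<And>b. b \<in> supp f \<Longrightarrow> d \<le> b"
    using wfp_on_less_least[OF wfp_on_supp order_refl] by blast
  have "gcoeff f a = 0" if "a < d" for a
    using d(2)[of a] that by (auto simp: supp_def)
  with d(1) show ?thesis by (auto simp: supp_def)
qed

lemma gseries_ex_inverse:
  assumes "f \<noteq> 0"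
  shows "\<exists>g. f * g = (1 :: gseries)"
proof -
  obtain d where d: "gcoeff f d \<noteq> 0" "\<And>a. a < d \<Longrightarrow> gcoeff f a = 0"
    using gseries_nonzero_least[OF assms] by blast
  define u where "u = gmonom (inverse (gcoeff f d)) (- d)"
  define e where "e = 1 - u * f"
  have e_coeff: "gcoeff e a = (if a = 0 then 1 else 0) - inverse (gcoeff f d) * gcoeff f (a + d)" for a
    by (simp add: e_def u_def coeff_one coeff_monom_mult)
  have e0: "gcoeff e a = 0" if "a \<le> 0" for a
    using that d by (cases "a = 0") (auto simp: e_coeff)
  have "\<exists>s>0. \<forall>a<s. gcoeff e a = 0"
  proof (cases "e = 0")
    case True
    then show ?thesis by (intro exI[of _ 1]) simp
  next
    case False
    then obtain s where "gcoeff e s \<noteq> 0" "\<And>a. a < s \<Longrightarrow> gcoeff e a = 0"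
      using gseries_nonzero_least[OF False] by blast
    then show ?thesis using e0[of s] by (intro exI[of _ s]) force
  qed
  then obtain g where "(1 - e) * g = 1" using gseries_geometric_inverse by blast
  then have "f * (u * g) = 1" by (simp add: e_def ac_simps)
  then show ?thesis ..
qed

instantiation gseries :: field
begin

definition inverse_gseries :: "gseries \<Rightarrow> gseries" where
  "inverse f = (if f = 0 then 0 else SOME g. f * g = (1 :: gseries))"

definition divide_gseries :: "gseries \<Rightarrow> gseries \<Rightarrow> gseries" where
  "f div g = f * inverse (g :: gseries)"

instance
proof
  fix f g :: gseries
  show "f \<noteq> 0 \<Longrightarrow> inverse f * f = 1"
    using someI_ex[OF gseries_ex_inverse[of f]] by (simp add: inverse_gseries_def mult.commute)
  show "f div g = f * inverse g" by (simp add: divide_gseries_def)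
  show "inverse (0 :: gseries) = 0" by (simp add: inverse_gseries_def)
qed

end

text \<open>Only meaningful for \<open>f \<noteq> 0\<close>.\<close>

definition deg :: "gseries \<Rightarrow> real" where
  "deg f = (LEAST a. gcoeff f a \<noteq> 0)"

lemma coeff_deg:
  assumes "f \<noteq> 0"
  shows "gcoeff f (deg f) \<noteq> 0" "a < deg f \<Longrightarrow> gcoeff f a = 0"
proof -
  obtain d where d: "gcoeff f d \<noteq> 0" "\<And>a. a < d \<Longrightarrow> gcoeff f a = 0"
    using gseries_nonzero_least[OF assms] by blast
  have "deg f = d"
    unfolding deg_def using d by (intro Least_equality) (auto simp: not_less[symmetric])
  then show "gcoeff f (deg f) \<noteq> 0" "a < deg f \<Longrightarrow> gcoeff f a = 0" using d by auto
qed

lemma deg_monom: "c \<noteq> 0 \<Longrightarrow> deg (gmonom c a) = a"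
  unfolding deg_def by (rule Least_equality) (auto simp: coeff_monom split: if_splits)

lemma monom_eq_0_iff: "gmonom c a = 0 \<longleftrightarrow> c = 0"
  by (metis coeff_monom coeff_zero gseries_eqI)

section \<open>Tropical rank\<close>

text \<open>An \<open>r \<times> r\<close> matrix is a function on pairs of indices, restricted to indices below \<open>r\<close>.\<close>

definition perm_sum :: "nat \<Rightarrow> (nat \<Rightarrow> nat \<Rightarrow> real) \<Rightarrow> (nat \<Rightarrow> nat) \<Rightarrow> real" where
  "perm_sum r m \<sigma> = (\<Sum>i<r. m i (\<sigma> i))"

definition tropically_singular :: "nat \<Rightarrow> (nat \<Rightarrow> nat \<Rightarrow> real) \<Rightarrow> bool" where
  "tropically_singular r m \<longleftrightarrow>
    (\<exists>\<sigma> \<tau>. \<sigma> permutes {..<r} \<and> \<tau> permutes {..<r} \<and> \<sigma> \<noteq> \<tau> \<and>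
      perm_sum r m \<sigma> = Min (perm_sum r m ` {\<rho>. \<rho> permutes {..<r}}) \<and>
      perm_sum r m \<tau> = Min (perm_sum r m ` {\<rho>. \<rho> permutes {..<r}}))"

text \<open>A submatrix is given by injective enumerations \<open>p\<close>, \<open>q\<close> of its rows and columns. The index
  types carry no order; the order of enumeration does not affect singularity.\<close>

definition has_nonsingular_submatrix :: "real^'n^'d \<Rightarrow> nat \<Rightarrow> bool" where
  "has_nonsingular_submatrix M r \<longleftrightarrow>
    (\<exists>(p :: nat \<Rightarrow> 'd) (q :: nat \<Rightarrow> 'n). inj_on p {..<r} \<and> inj_on q {..<r} \<and>
      \<not> tropically_singular r (\<lambda>i j. M $ p i $ q j))"

definition tropical_rank :: "real^'n^'d \<Rightarrow> nat" where
  "tropical_rank M = (GREATEST r. has_nonsingular_submatrix M r)"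

lemma has_nonsingular_submatrix_le:
  fixes M :: "real^'n^'d"
  assumes "has_nonsingular_submatrix M r"
  shows "r \<le> CARD('d)"
proof -
  obtain p :: "nat \<Rightarrow> 'd" where "inj_on p {..<r}"
    using assms by (auto simp: has_nonsingular_submatrix_def)
  then have "card {..<r} \<le> CARD('d)" by (intro card_inj_on_le[of p]) auto
  then show ?thesis by simp
qed

lemma has_nonsingular_submatrix_tropical_rank:
  "has_nonsingular_submatrix M (tropical_rank M)"
proof -
  have "has_nonsingular_submatrix M 0"
    by (simp add: has_nonsingular_submatrix_def tropically_singular_def)
  then show ?thesis
    unfolding tropical_rank_def using has_nonsingular_submatrix_le by (rule GreatestI_nat)
qed

section \<open>Kapranov rank\<close>

definition trop_linear_space :: "(gseries^'d) set \<Rightarrow> (real^'d) set" where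
  "trop_linear_space V = {\<chi> i. deg (f $ i) |f. f \<in> V \<and> (\<forall>i. f $ i \<noteq> 0)}"

definition kapranov_rank :: "real^'n^'d \<Rightarrow> nat" where
  "kapranov_rank M = (LEAST k. \<exists>V :: (gseries^'d) set.
    vec.subspace V \<and> vec.dim V = k \<and> columns M \<subseteq> trop_linear_space V)"

lemma trop_linear_space_UNIV: "trop_linear_space UNIV = UNIV"
proof -
  have "x \<in> trop_linear_space UNIV" for x :: "real^'d"
    by (auto simp: trop_linear_space_def deg_monom monom_eq_0_iff vec_eq_iff
        intro!: exI[of _ "\<chi> i. gmonom 1 (x $ i)"])
  then show ?thesis by blast
qed

lemma kapranov_rank_attained:
  fixes M :: "real^'n^'d"
  shows "\<exists>V :: (gseries^'d) set. vec.subspace V \<and> vec.dim V = kapranov_rank M \<and>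
    columns M \<subseteq> trop_linear_space V"
  unfolding kapranov_rank_def
  by (rule LeastI_ex) (auto simp: trop_linear_space_UNIV intro: vec.subspace_UNIV)

end

theory Submission
  imports Defs
begin

text \<open>
  Kapranov rank at most 2 means that the entries of the matrix are the degrees of
  \<open>t\<close> to the power \<open>\<alpha> i + \<beta> j\<close> times \<open>x i - y j\<close> for suitable series \<open>x i\<close>, \<open>y j\<close>: the column
  \<open>j\<close> then lifts to a combination of the two vectors \<open>(t\<^sup>\<alpha>\<^sup>i x i)\<close> and \<open>(t\<^sup>\<alpha>\<^sup>i)\<close>. Now
  \<open>deg (x - y)\<close> is an ultrametric, read with the order reversed, so up to row and column
  shifts \<open>\<alpha>\<close>, \<open>\<beta>\<close> the matrix has to be the rows-against-columns part of an ultrametric. Such a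
  bipartite part extends to an ultrametric as soon as no cycle attains its minimum only once,
  and cycles of length four suffice, since a chord splits any longer cycle. This is the condition
  \<open>min (P i k) (min (P i' k) (P i' j)) \<le> P i j\<close> that links the two halves of the proof.

  Tropical side (\<open>rank_two_normal_form\<close>): choose the shifts so that one column vanishes and every
  column has minimum 0. If the four-point condition failed, the two rows and two columns
  involved, together with the zero column and a row in which the second column vanishes, would
  form a 3 by 3 submatrix with a unique optimal permutation.

  Algebraic side (\<open>four_point_realizable\<close>): an ultrametric is a tree of nested clusters, one
  partition for every height \<open>h\<close>. The series whose coefficient of \<open>t\<^sup>h\<close> is a code for the
  cluster at height \<open>h\<close> realizes it, because two series agree exactly as long as the
  clusters do. The residue field is infinite, so there are enough codes.

  Conversely, a space of dimension at most 1 only contains multiples of a single vector, so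
  Kapranov rank at most 1 writes the entries as \<open>v i + c j\<close>. All permutations then have the same
  sum, and every 2 by 2 submatrix is singular.
\<close>

section \<open>Degrees of generalized power series\<close>

lemma deg_eqI:
  assumes "gcoeff f a \<noteq> 0" "\<And>x. x < a \<Longrightarrow> gcoeff f x = 0"
  shows "f \<noteq> 0" "deg f = a"
proof -
  show "f \<noteq> 0" using assms(1) by auto
  show "deg f = a"
    unfolding deg_def using assms by (intro Least_equality) (auto simp: not_less[symmetric])
qed

lemma deg_mult:
  assumes "f \<noteq> 0" "g \<noteq> 0"
  shows "deg (f * g) = deg f + deg g"
proof (rule deg_eqI(2))
  have "x = deg f" if "x \<in> supp f" "deg f + deg g - x \<in> supp g" for x
  proof -
    have "\<not> x < deg f" "\<not> deg f + deg g - x < deg g"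
      using that coeff_deg(2)[OF assms(1)] coeff_deg(2)[OF assms(2)] by (auto simp: supp_def)
    then show ?thesis by linarith
  qed
  then have "{a. a \<in> supp f \<and> deg f + deg g - a \<in> supp g} = {deg f}"
    using coeff_deg(1)[OF assms(1)] coeff_deg(1)[OF assms(2)] by (auto simp: supp_def)
  then show "gcoeff (f * g) (deg f + deg g) \<noteq> 0"
    using coeff_deg(1)[OF assms(1)] coeff_deg(1)[OF assms(2)] by (simp add: coeff_mult)
next
  fix x assume "x < deg f + deg g"
  then show "gcoeff (f * g) x = 0"
    by (intro coeff_mult_eq_0'[of "deg f" f "deg g" g] coeff_deg(2) assms)
qed

lemma coeff_sum: "gcoeff (\<Sum>h\<in>H. f h) a = (\<Sum>h\<in>H. gcoeff (f h) a)"
  by (induction H rule: infinite_finite_induct) auto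

section \<open>Realizing a four-point condition by series\<close>

text \<open>At height \<open>h\<close> the rows and columns fall into clusters, a row \<open>i\<close> and a column \<open>j\<close> lying
  together iff \<open>P i j > h\<close>. A cluster is named by its set of columns. All rows that
  share a cluster with no column get the same name, the empty set; this is harmless, since
  only differences of a row and a column matter, and no column has that name.\<close>

lemma four_point_realizable:
  fixes P :: "'d::finite \<Rightarrow> 'n::finite \<Rightarrow> real"
  assumes four: "\<And>i i' j k. min (P i k) (min (P i' k) (P i' j)) \<le> P i j"
  shows "\<exists>x y :: _ \<Rightarrow> gseries. \<forall>i j. x i - y j \<noteq> 0 \<and> deg (x i - y j) = P i j"
proof -
  define A where "A i h = {j. h < P i j}" for i h
  define B where "B j h = insert j {k. \<exists>i. h < P i j \<and> h < P i k}" for j h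
  have same: "A i h = B j h" if "h < P i j" for i j h
  proof
    show "A i h \<subseteq> B j h" using that by (auto simp: A_def B_def)
    show "B j h \<subseteq> A i h"
    proof
      fix k assume "k \<in> B j h"
      then consider "k = j" | i' where "h < P i' j" "h < P i' k" by (auto simp: B_def)
      then show "k \<in> A i h"
      proof cases
        case 1
        then show ?thesis using that by (simp add: A_def)
      next
        case 2
        then show ?thesis using that four[of i j i' k] by (simp add: A_def min_def split: if_splits)
      qed
    qed
  qed
  have different: "A i (P i j) \<noteq> B j (P i j)" for i j
    by (auto simp: A_def B_def)
  obtain e :: "'n set \<Rightarrow> nat" where e: "inj e"
    using finite_imp_inj_to_nat_seg[of "UNIV :: 'n set set"] by auto
  define H where "H = (\<lambda>(i, j). P i j) ` UNIV"
  have H: "finite H" "P i j \<in> H" for i j by (auto simp: H_def)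
  define x where "x i = (\<Sum>h\<in>H. gmonom (of_nat (e (A i h))) h)" for i
  define y where "y j = (\<Sum>h\<in>H. gmonom (of_nat (e (B j h))) h)" for j
  have coeff: "gcoeff (x i - y j) a
      = (if a \<in> H then of_nat (e (A i a)) - of_nat (e (B j a)) else 0)" for i j a
    using H(1) by (simp add: x_def y_def coeff_sum coeff_monom)
  have at: "gcoeff (x i - y j) (P i j) \<noteq> 0" for i j
    unfolding coeff using different[of i j] e H(2) by (simp add: inj_eq)
  have below: "gcoeff (x i - y j) a = 0" if "a < P i j" for i j a
    unfolding coeff using same[OF that] by simp
  show ?thesis
    using deg_eqI[OF at below] by blast
qed

section \<open>Matrices without tropically non-singular three by three submatrix\<close>

lemma unique_min_perm_imp_nonsingular:
  assumes \<sigma>: "\<sigma> permutes {..<r}"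
    and min: "\<And>\<tau>. \<tau> permutes {..<r} \<Longrightarrow> \<tau> \<noteq> \<sigma> \<Longrightarrow> perm_sum r m \<sigma> < perm_sum r m \<tau>"
  shows "\<not> tropically_singular r m"
proof -
  have "Min (perm_sum r m ` {\<rho>. \<rho> permutes {..<r}}) = perm_sum r m \<sigma>"
    using \<sigma> min by (intro Min_eqI) (auto simp: finite_permutations order_le_less)
  then show ?thesis
    unfolding tropically_singular_def using min by (metis less_irrefl)
qed

lemma permutes_3_cases:
  assumes "\<tau> permutes {..<3::nat}" "\<tau> \<noteq> id"
  shows "(\<tau> 0, \<tau> 1, \<tau> 2) \<in> {(0, 2, 1), (1, 0, 2), (1, 2, 0), (2, 0, 1), (2, 1, 0)}"
proof -
  have lt: "\<tau> 0 < 3" "\<tau> 1 < 3" "\<tau> 2 < 3"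
    using permutes_in_image[OF assms(1), of 0] permutes_in_image[OF assms(1), of 1]
      permutes_in_image[OF assms(1), of 2] by simp_all
  have neq: "\<tau> 0 \<noteq> \<tau> 1" "\<tau> 0 \<noteq> \<tau> 2" "\<tau> 1 \<noteq> \<tau> 2"
    using permutes_inj[OF assms(1)] by (auto simp: inj_eq)
  have "\<not> (\<tau> 0 = 0 \<and> \<tau> 1 = 1 \<and> \<tau> 2 = 2)"
  proof
    assume fix': "\<tau> 0 = 0 \<and> \<tau> 1 = 1 \<and> \<tau> 2 = 2"
    have "\<tau> n = n" for n
    proof (cases "n < 3")
      case True
      then have "n = 0 \<or> n = 1 \<or> n = 2" by auto
      then show ?thesis using fix' by auto
    next
      case False
      then show ?thesis using permutes_not_in[OF assms(1)] by simp
    qed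
    then show False using assms(2) by auto
  qed
  moreover have "\<tau> 0 = 0 \<or> \<tau> 0 = 1 \<or> \<tau> 0 = 2" "\<tau> 1 = 0 \<or> \<tau> 1 = 1 \<or> \<tau> 1 = 2"
    "\<tau> 2 = 0 \<or> \<tau> 2 = 1 \<or> \<tau> 2 = 2"
    using lt by linarith+
  ultimately show ?thesis using neq by (elim disjE) simp_all
qed

text \<open>The rows and columns are arranged so that the diagonal is the candidate for a unique
  minimum.\<close>

lemma three_by_three_unique_min:
  fixes M :: "real^'n^'d"
  assumes no3: "\<not> has_nonsingular_submatrix M 3"
    and rows: "i \<noteq> i'" "i \<noteq> i''" "i' \<noteq> i''" and cols: "j \<noteq> j'" "j \<noteq> j''" "j' \<noteq> j''"
    and less: "s < M$i$j + M$i'$j'' + M$i''$j'" "s < M$i$j' + M$i'$j + M$i''$j''"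
      "s < M$i$j' + M$i'$j'' + M$i''$j" "s < M$i$j'' + M$i'$j + M$i''$j'"
      "s < M$i$j'' + M$i'$j' + M$i''$j"
  shows "s < M$i$j + M$i'$j' + M$i''$j''"
proof (rule ccontr)
  assume not_less: "\<not> ?thesis"
  define p where "p = (\<lambda>n::nat. if n = 0 then i else if n = 1 then i' else i'')"
  define q where "q = (\<lambda>n::nat. if n = 0 then j else if n = 1 then j' else j'')"
  let ?m = "\<lambda>a b. M $ p a $ q b"
  have set3: "{..<3} = {0, 1, 2::nat}" by auto
  have inj: "inj_on p {..<3}" "inj_on q {..<3}"
    using rows cols by (auto simp: inj_on_def p_def q_def set3)
  have sum3: "perm_sum 3 ?m \<tau> = ?m 0 (\<tau> 0) + ?m 1 (\<tau> 1) + ?m 2 (\<tau> 2)" for \<tau>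
    by (simp add: perm_sum_def set3)
  have "\<not> tropically_singular 3 ?m"
  proof (rule unique_min_perm_imp_nonsingular)
    show "id permutes {..<3::nat}" by (rule permutes_id)
    fix \<tau> :: "nat \<Rightarrow> nat" assume "\<tau> permutes {..<3}" "\<tau> \<noteq> id"
    then have "(\<tau> 0, \<tau> 1, \<tau> 2) \<in> {(0, 2, 1), (1, 0, 2), (1, 2, 0), (2, 0, 1), (2, 1, 0)}"
      by (rule permutes_3_cases)
    then show "perm_sum 3 ?m id < perm_sum 3 ?m \<tau>"
      unfolding sum3 using less not_less by (auto simp: p_def q_def)
  qed
  with inj no3 show False unfolding has_nonsingular_submatrix_def by blast
qed

text \<open>Why these shifts: the row shifts are determined by the choice of a column that is to meet all
  rows at height 0, that is, to branch off at the root of the tree. Any other column meets the rows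
  at the root or further up, and if its entries are not constant it meets some row exactly at the
  root; so its shift has to bring its minimum to 0.\<close>

lemma rank_two_normal_form:
  fixes M :: "real^'n^'d"
  assumes no3: "\<not> has_nonsingular_submatrix M 3"
  shows "\<exists>\<alpha> \<beta> P. (\<forall>i j. M $ i $ j = \<alpha> i + \<beta> j + P i j) \<and>
    (\<forall>i i' j k. min (P i k) (min (P i' k) (P i' j)) \<le> P i j)"
proof -
  fix c :: 'n
  define \<alpha> where "\<alpha> i = M $ i $ c" for i
  define \<beta> where "\<beta> j = (MIN i. M $ i $ j - \<alpha> i)" for j
  define P where "P i j = M $ i $ j - \<alpha> i - \<beta> j" for i j
  have M_eq: "M $ i $ j = \<alpha> i + \<beta> j + P i j" for i j
    by (simp add: P_def)
  have nonneg: "0 \<le> P i j" for i j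
    by (simp add: P_def \<beta>_def)
  have ex_0: "\<exists>i. P i j = 0" for j
  proof -
    have "\<beta> j \<in> range (\<lambda>i. M $ i $ j - \<alpha> i)"
      unfolding \<beta>_def by (rule Min_in) auto
    then show ?thesis by (auto simp: P_def)
  qed
  have P_c: "P i c = 0" for i
    by (simp add: P_def \<beta>_def \<alpha>_def)
  have key: "min (P i k) (P i' k) \<le> P i j" if less: "P i j < P i' j" for i i' j k
  proof (rule ccontr)
    assume "\<not> ?thesis"
    then have k: "P i j < P i k" "P i j < P i' k" by auto
    obtain z where z: "P z k = 0" using ex_0 by blast
    note pos = nonneg[of i j] nonneg[of z j]
    have rows: "i \<noteq> i'" "i \<noteq> z" "i' \<noteq> z" using less k z pos by auto
    have cols: "j \<noteq> c" "j \<noteq> k" "c \<noteq> k" using less k P_c pos by auto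
    \<comment> \<open>The diagonal of rows \<open>i\<close>, \<open>i'\<close>, \<open>z\<close> and columns \<open>j\<close>, \<open>c\<close>, \<open>k\<close> contributes \<open>P i j + 0 + 0\<close>,
      and each other permutation contributes more.\<close>
    have "M$i$j + M$i'$c + M$z$k < M$i$j + M$i'$c + M$z$k"
      by (rule three_by_three_unique_min[OF no3 rows cols])
        (use less k z P_c pos in \<open>simp_all add: M_eq\<close>)
    then show False by simp
  qed
  have "min (P i k) (min (P i' k) (P i' j)) \<le> P i j" for i i' j k
    using key[of i j i' k] by linarith
  with M_eq show ?thesis
    by (intro exI[of _ \<alpha>] exI[of _ \<beta>] exI[of _ P]) (intro conjI allI)
qed

section \<open>Bounds on the Kapranov rank\<close>

lemma kapranov_rank_le_2:
  fixes M :: "real^'n^'d"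
  assumes "\<not> has_nonsingular_submatrix M 3"
  shows "kapranov_rank M \<le> 2"
proof -
  obtain \<alpha> \<beta> P where M_eq: "\<forall>i j. M $ i $ j = \<alpha> i + \<beta> j + P i j"
    and four: "\<forall>i i' j k. min (P i k) (min (P i' k) (P i' j)) \<le> P i j"
    using rank_two_normal_form[OF assms] by (elim exE conjE)
  obtain x y :: "_ \<Rightarrow> gseries"
    where xy: "\<forall>i j. x i - y j \<noteq> 0 \<and> deg (x i - y j) = P i j"
    using four_point_realizable[of P, OF four[rule_format]] by (elim exE)
  have nz: "x i - y j \<noteq> 0" and deg_xy: "deg (x i - y j) = P i j" for i j
    using xy by blast+
  define v w :: "gseries^'d"
    where "v = (\<chi> i. gmonom 1 (\<alpha> i) * x i)" and "w = (\<chi> i. gmonom 1 (\<alpha> i))"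
  let ?V = "vec.span {v, w}"
  have "column j M \<in> trop_linear_space ?V" for j
  proof -
    define f where "f = gmonom 1 (\<beta> j) *s (v - y j *s w)"
    have f_nth: "f $ i = gmonom 1 (\<beta> j) * (gmonom 1 (\<alpha> i) * (x i - y j))" for i
      by (simp add: f_def v_def w_def algebra_simps)
    have "f \<in> ?V"
      unfolding f_def by (intro vec.span_scale vec.span_diff vec.span_base) auto
    moreover have "f $ i \<noteq> 0" for i
      using nz by (simp add: f_nth monom_eq_0_iff)
    moreover have "deg (f $ i) = M $ i $ j" for i
      using nz by (simp add: f_nth deg_mult deg_monom monom_eq_0_iff deg_xy M_eq)
    ultimately show ?thesis
      unfolding trop_linear_space_def by (auto simp: column_def vec_eq_iff intro!: exI[of _ f])
  qed
  then have "columns M \<subseteq> trop_linear_space ?V" by (auto simp: columns_def)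
  then have "kapranov_rank M \<le> vec.dim ?V"
    unfolding kapranov_rank_def by (intro Least_le) (auto intro: vec.subspace_span)
  also have "\<dots> \<le> card {v, w}"
    by (simp add: vec.dim_span vec.dim_le_card')
  also have "\<dots> \<le> 2" using card_insert_le_m1[of 2 "{w}" v] by simp
  finally show ?thesis .
qed

lemma tropically_singular_of_sum_form:
  assumes "r \<ge> 2" and m: "\<And>i j. m i j = v i + c j"
  shows "tropically_singular r m"
proof -
  have const: "perm_sum r m \<sigma> = (\<Sum>i<r. v i) + (\<Sum>i<r. c i)" if "\<sigma> permutes {..<r}" for \<sigma>
    using sum.permute[OF that, of c] by (simp add: perm_sum_def m sum.distrib o_def)
  have id: "(id :: nat \<Rightarrow> nat) permutes {..<r}" by (rule permutes_id)
  then have "perm_sum r m ` {\<rho>. \<rho> permutes {..<r}} = {(\<Sum>i<r. v i) + (\<Sum>i<r. c i)}"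
    using const by (auto simp: image_iff intro!: exI[of _ id])
  moreover have "Transposition.transpose 0 1 permutes {..<r}"
    using assms(1) by (intro permutes_swap_id) auto
  moreover have "Transposition.transpose 0 1 \<noteq> (id :: nat \<Rightarrow> nat)"
    by (simp add: transpose_eq_id_iff)
  ultimately show ?thesis
    unfolding tropically_singular_def using const id by (metis Min_singleton)
qed

lemma kapranov_rank_le_1_imp_sum_form:
  fixes M :: "real^'n^'d"
  assumes "kapranov_rank M \<le> 1"
  obtains v c where "\<And>i j. M $ i $ j = v i + c j"
proof -
  obtain V :: "(gseries^'d) set" where dim: "vec.dim V \<le> 1"
    and cols: "columns M \<subseteq> trop_linear_space V"
    using kapranov_rank_attained[of M] assms by metis
  obtain S where S: "vec.independent S" "V \<subseteq> vec.span S" "card S = vec.dim V"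
    using vec.basis_exists[of V] by metis
  have "\<forall>s\<in>S. \<forall>s'\<in>S. s = s'"
    using S(3) dim vec.finiteI_independent[OF S(1)] card_le_Suc0_iff_eq[of S] by simp
  then obtain b where "S \<subseteq> {b}" by blast
  then have V: "V \<subseteq> range (\<lambda>k. k *s b)"
    using S(2) vec.span_mono[of S "{b}"] by (auto simp: vec.span_singleton)
  have "\<exists>c. \<forall>i. M $ i $ j = deg (b $ i) + c" for j
  proof -
    have "column j M \<in> trop_linear_space V" using cols by (auto simp: columns_def)
    then obtain f where f: "f \<in> V" "\<And>i. f $ i \<noteq> 0" "column j M = (\<chi> i. deg (f $ i))"
      unfolding trop_linear_space_def by blast
    obtain k where k: "f = k *s b" using f(1) V by blast
    have "M $ i $ j = deg (b $ i) + deg k" for i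
      using f(2)[of i] f(3) by (auto simp: k column_def vec_eq_iff deg_mult)
    then show ?thesis by blast
  qed
  then obtain c where "\<And>i j. M $ i $ j = deg (b $ i) + c j" by metis
  then show thesis by (rule that)
qed

theorem theorem6p5:
  fixes M :: "real^'n^'d"
  assumes "tropical_rank M = 2"
  shows "kapranov_rank M = 2"
proof (rule antisym)
  have "\<not> has_nonsingular_submatrix M 3"
  proof
    assume "has_nonsingular_submatrix M 3"
    then have "3 \<le> tropical_rank M"
      unfolding tropical_rank_def using has_nonsingular_submatrix_le by (rule Greatest_le_nat)
    then show False using assms by simp
  qed
  then show "kapranov_rank M \<le> 2" by (rule kapranov_rank_le_2)
  show "2 \<le> kapranov_rank M"
  proof (rule ccontr)
    assume "\<not> 2 \<le> kapranov_rank M"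
    then have "kapranov_rank M \<le> 1" by simp
    then obtain v c where "\<And>i j. M $ i $ j = v i + c j"
      using kapranov_rank_le_1_imp_sum_form by blast
    then have "\<not> has_nonsingular_submatrix M 2"
      using tropically_singular_of_sum_form[of 2 _ "v \<circ> p" "c \<circ> q" for p q]
      unfolding has_nonsingular_submatrix_def by simp
    then show False using has_nonsingular_submatrix_tropical_rank[of M] assms by simp
  qed
qed

end
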